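(* The following statements hold. (1) Each cosmic space is $\mathsf{cs}$-separable. (2) Each $\mathsf{cs}$-cosmic space is $\mathsf{k}$-separable. (3) Each $\mathsf{as}$-cosmic space is cometrizable.
   Context: Regular spaces are assumed to be Hausdorff. Networks. Let $\mathcal N$ be a family of subsets of a topological space $X$. $\mathcal N$ is a network if for each open set $U\subseteq X$ and point $x\in U$ there exists $N\in\mathcal N$ with $x\in N\subseteq U$. $\mathcal N$ is a $\mathsf{cs}$-network if for each open set $U\subseteq X$ and each sequence $(x_n)_{n\in\omega}$ of points of $X$ converging to a point $x\in U$ there exists $N\in\mathcal N$ such that $N\subseteq U$ and the set $\{n\in\omega:x_n\in N\}$ is infinite. A sequence $(S_n)_{n\in\omega}$ of closed subsets of $X$ accumulates at a point $x\in X$ if for each neighborhood $O_x$ of $x$ the set $\{n\in\omega:O_x\cap S_n\neq\emptyset\}$ is infinite. $\mathcal N$ is an $\mathsf{as}$-network if for each open set $U\subseteq X$ and each sequence $(S_n)_{n\in\omega}$ of closed subsets of $X$ that accumulates at a point $x\in U$ there exists $N\in\mathcal N$ such that $N\subseteq U$ and the set $\{n\in\omega:N\cap S_n\neq\emptyset\}$ is infinite. A regular topological space is called cosmic (resp. $\mathsf{cs}$-cosmic, $\mathsf{as}$-cosmic) if it has a countable network (resp. countable $\mathsf{cs}$-network, countable $\mathsf{as}$-network). A topological space $X$ is $\mathsf{cs}$-separable if it contains a countable set $D\subseteq X$ such that each point $x\in X$ is the limit of some convergent sequence $(x_n)_{n\in\omega}$ of points of $D$. A topological space $X$ is $\mathsf{k}$-separable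 if it contains a countable subset $D\subseteq X$ such that each compact set $K\subseteq X$ is contained in a compact set $C\subseteq X$ with $K\subseteq\overline{C\cap D}$. A topological space $X$ is called cometrizable if it admits a weaker (i.e. contained in the original topology) metrizable topology such that each point $x\in X$ has a (not necessarily open) neighborhood base, with respect to the original topology of $X$, consisting of sets that are closed in the metrizable topology. *)

theory Defs
  imports "HOL-Analysis.Analysis"
begin

definition network_in :: "'a topology \<Rightarrow> 'a set set \<Rightarrow> bool" where
  "network_in X \<N> \<longleftrightarrow>
     \<N> \<subseteq> Pow (topspace X) \<and>
     (\<forall>U x. openin X U \<and> x \<in> U \<longrightarrow> (\<exists>N\<in>\<N>. x \<in> N \<and> N \<subseteq> U))"

text \<open>The predicate \<^const>\<open>limitin\<close> only constrains the tail of a sequence, so membership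
  of every term in the space is required separately.\<close>

definition cs_network_in :: "'a topology \<Rightarrow> 'a set set \<Rightarrow> bool" where
  "cs_network_in X \<N> \<longleftrightarrow>
     \<N> \<subseteq> Pow (topspace X) \<and>
     (\<forall>U (s :: nat \<Rightarrow> 'a) x.
        openin X U \<and> range s \<subseteq> topspace X \<and> x \<in> U \<and> limitin X s x sequentially
        \<longrightarrow> (\<exists>N\<in>\<N>. N \<subseteq> U \<and> infinite {n. s n \<in> N}))"

text \<open>Neighbourhoods are not assumed to be open.\<close>

definition accumulates_at :: "'a topology \<Rightarrow> (nat \<Rightarrow> 'a set) \<Rightarrow> 'a \<Rightarrow> bool" where
  "accumulates_at X S x \<longleftrightarrow>
     x \<in> topspace X \<and>
     (\<forall>W. W \<subseteq> topspace X \<and> (\<exists>V. openin X V \<and> x \<in> V \<and> V \<subseteq> W)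
        \<longrightarrow> infinite {n. W \<inter> S n \<noteq> {}})"

definition as_network_in :: "'a topology \<Rightarrow> 'a set set \<Rightarrow> bool" where
  "as_network_in X \<N> \<longleftrightarrow>
     \<N> \<subseteq> Pow (topspace X) \<and>
     (\<forall>U (S :: nat \<Rightarrow> 'a set) x.
        openin X U \<and> (\<forall>n. closedin X (S n)) \<and> x \<in> U \<and> accumulates_at X S x
        \<longrightarrow> (\<exists>N\<in>\<N>. N \<subseteq> U \<and> infinite {n. N \<inter> S n \<noteq> {}}))"

text \<open>The library's \<^const>\<open>regular_space\<close> carries no separation axiom for points, whereas
  regular spaces are here Hausdorff by convention.\<close>

definition cosmic_space :: "'a topology \<Rightarrow> bool" where
  "cosmic_space X \<longleftrightarrow>
     regular_space X \<and> Hausdorff_space X \<and> (\<exists>\<N>. countable \<N> \<and> network_in X \<N>)"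

definition cs_cosmic_space :: "'a topology \<Rightarrow> bool" where
  "cs_cosmic_space X \<longleftrightarrow>
     regular_space X \<and> Hausdorff_space X \<and> (\<exists>\<N>. countable \<N> \<and> cs_network_in X \<N>)"

definition as_cosmic_space :: "'a topology \<Rightarrow> bool" where
  "as_cosmic_space X \<longleftrightarrow>
     regular_space X \<and> Hausdorff_space X \<and> (\<exists>\<N>. countable \<N> \<and> as_network_in X \<N>)"

definition cs_separable_space :: "'a topology \<Rightarrow> bool" where
  "cs_separable_space X \<longleftrightarrow>
     (\<exists>D. countable D \<and> D \<subseteq> topspace X \<and>
        (\<forall>x\<in>topspace X. \<exists>s :: nat \<Rightarrow> 'a. range s \<subseteq> D \<and> limitin X s x sequentially))"

definition k_separable_space :: "'a topology \<Rightarrow> bool" where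
  "k_separable_space X \<longleftrightarrow>
     (\<exists>D. countable D \<and> D \<subseteq> topspace X \<and>
        (\<forall>K. compactin X K \<longrightarrow>
           (\<exists>C. compactin X C \<and> K \<subseteq> C \<and> K \<subseteq> X closure_of (C \<inter> D))))"

text \<open>The members of a neighbourhood base in the sense of \<^const>\<open>neighbourhood_base_of\<close>
  need not be open. Here they are neighbourhoods in \<open>X\<close>, closed in the weaker topology \<open>Y\<close>.\<close>

definition cometrizable_space :: "'a topology \<Rightarrow> bool" where
  "cometrizable_space X \<longleftrightarrow>
     (\<exists>Y. topspace Y = topspace X \<and> (\<forall>U. openin Y U \<longrightarrow> openin X U) \<and>
        metrizable_space Y \<and> neighbourhood_base_of (closedin Y) X)"

end

theory Submission
  imports Defs
begin

text \<open>
  Two constructions carry the three parts.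

  The first gives the countable dense sets of parts (1) and (2): choose a point in every nonempty
  finite intersection of members of a countable network. Approach a point \<open>x\<close> by the points chosen
  in the intersection of all those members, among the first \<open>n\<close> of an enumeration, that contain
  \<open>x\<close>. Since the network has members around \<open>x\<close> inside every neighbourhood of \<open>x\<close>, these
  points converge to \<open>x\<close> (\<open>limitin_approximant\<close>), which is part (1).
  For part (2), a countable cs-network contains, for every compact \<open>K\<close> inside an open \<open>U\<close>, a
  finite cover of \<open>K\<close> by members inside \<open>U\<close> (\<open>cs_network_finite_cover\<close>). Enumerate the finite
  covers of \<open>K\<close> instead of single members. Every stage then involves only finitely many
  intersections, so that all points of \<open>K\<close> together have finitely many \<open>n\<close>-th approximants, and
  every neighbourhood of \<open>K\<close> contains the approximants of almost all stages. Hence \<open>K\<close>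
  together with its approximants is compact. Each point \<open>x\<close> of \<open>K\<close> is still the limit of its
  approximants, because for every neighbourhood of \<open>x\<close> some finite cover of \<open>K\<close> has all its
  members around \<open>x\<close> inside that neighbourhood.

  The second is a coarser metrizable topology on a cosmic space. Such a space is Lindelof,
  hence normal, so that any two disjoint members of a countable network of closed sets are separated
  by a continuous real function; these countably many functions separate points and induce the
  topology (\<open>cosmic_coarser_metrizable\<close>). It makes compact subsets sequentially compact, as
  needed for the finite covers above, and it is the topology that witnesses part (3).
  Let \<open>x\<close> lie in an open \<open>V\<close> whose closure lies in \<open>U\<close>. The complement of the closure of \<open>V\<close> is
  a union of members \<open>M\<^sub>0, M\<^sub>1, \<dots>\<close> of a countable as-network of closed sets. Surround each
  \<open>M\<^sub>j\<close> by a set \<open>G\<^sub>j\<close>, open in the coarser topology, whose closure misses the first \<open>j\<close> members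
  contained in \<open>V\<close>, together with a fixed one that contains \<open>x\<close>. Every member contained in \<open>V\<close>
  then meets only finitely many of these closures, so by the as-network property they do not
  accumulate at \<open>x\<close>, and none of them contains \<open>x\<close>. The complement of the union of all \<open>G\<^sub>j\<close> is
  therefore a neighbourhood of \<open>x\<close> inside \<open>U\<close> that is closed in the coarser topology.
\<close>

section \<open>Networks\<close>

lemma network_inE:
  assumes "network_in X \<N>" "openin X U" "x \<in> U"
  obtains N where "N \<in> \<N>" "x \<in> N" "N \<subseteq> U" "N \<subseteq> topspace X"
proof -
  obtain N where "N \<in> \<N>" "x \<in> N" "N \<subseteq> U"
    using assms unfolding network_in_def by blast
  with that openin_subset[OF assms(2)] show ?thesis by blast
qed

lemma as_network_inE:
  assumes "as_network_in X \<N>" "openin X U" "\<And>n. closedin X (S n)" "x \<in> U" "accumulates_at X S x"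
  obtains N where "N \<in> \<N>" "N \<subseteq> U" "N \<subseteq> topspace X" "infinite {n. N \<inter> S n \<noteq> {}}"
proof -
  obtain N where "N \<in> \<N>" "N \<subseteq> U" "infinite {n. N \<inter> S n \<noteq> {}}"
    using assms(1)[unfolded as_network_in_def, THEN conjunct2, rule_format, of U S x] assms(2-)
    by auto
  with that openin_subset[OF assms(2)] show ?thesis by blast
qed

lemma regular_open_shrink:
  assumes "regular_space X" "openin X U" "x \<in> U"
  obtains V where "openin X V" "x \<in> V" "X closure_of V \<subseteq> U"
proof -
  have "closedin X (topspace X - U)" "x \<in> topspace X - (topspace X - U)"
    using assms openin_subset by auto
  then obtain V where V: "openin X V" "x \<in> V" "disjnt (topspace X - U) (X closure_of V)"
    using assms(1) unfolding regular_space by blast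
  then have "X closure_of V \<subseteq> U"
    using closure_of_subset_topspace[of X V] by (auto simp: disjnt_iff)
  with V show ?thesis using that by blast
qed

text \<open>A constant sequence of points, respectively of singletons, converges to its value or
  accumulates at it; this is why both kinds of network are networks.\<close>

lemma cs_network_imp_network:
  assumes "cs_network_in X \<N>"
  shows "network_in X \<N>"
  unfolding network_in_def
proof (intro conjI allI impI)
  show "\<N> \<subseteq> Pow (topspace X)"
    using assms unfolding cs_network_in_def by blast
  fix U x assume Ux: "openin X U \<and> x \<in> U"
  then have "x \<in> topspace X"
    using openin_subset by blast
  then have "range (\<lambda>n::nat. x) \<subseteq> topspace X" "limitin X (\<lambda>n::nat. x) x sequentially"
    by (auto simp: limitin_sequentially)
  then obtain N where "N \<in> \<N>" "N \<subseteq> U" "infinite {n::nat. x \<in> N}"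
    using assms Ux unfolding cs_network_in_def by blast
  then show "\<exists>N\<in>\<N>. x \<in> N \<and> N \<subseteq> U"
    by (cases "x \<in> N") auto
qed

lemma as_network_imp_network:
  assumes "Hausdorff_space X" "as_network_in X \<N>"
  shows "network_in X \<N>"
  unfolding network_in_def
proof (intro conjI allI impI)
  show "\<N> \<subseteq> Pow (topspace X)"
    using assms unfolding as_network_in_def by blast
  fix U x assume Ux: "openin X U \<and> x \<in> U"
  then have x: "x \<in> topspace X"
    using openin_subset by blast
  have "closedin X {x}"
    using x assms(1) by (simp add: closedin_Hausdorff_sing_eq)
  moreover have "accumulates_at X (\<lambda>n. {x}) x"
    unfolding accumulates_at_def
  proof (intro conjI allI impI x)
    fix W assume "W \<subseteq> topspace X \<and> (\<exists>V. openin X V \<and> x \<in> V \<and> V \<subseteq> W)"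
    then have "{n::nat. W \<inter> {x} \<noteq> {}} = UNIV" by auto
    then show "infinite {n::nat. W \<inter> {x} \<noteq> {}}" by simp
  qed
  ultimately obtain N where "N \<in> \<N>" "N \<subseteq> U" "infinite {n::nat. N \<inter> {x} \<noteq> {}}"
    using as_network_inE[OF assms(2), of U "\<lambda>n. {x}" x] Ux by metis
  then show "\<exists>N\<in>\<N>. x \<in> N \<and> N \<subseteq> U"
    by (cases "x \<in> N") auto
qed

text \<open>Applying the network property to a smaller open set, whose closure lies in the given one, shows
  that in a regular space the members may be taken closed.\<close>

lemma network_closures:
  assumes "regular_space X" "network_in X \<N>"
  shows "network_in X ((closure_of) X ` \<N>)"
  unfolding network_in_def
proof (intro conjI allI impI)
  show "(closure_of) X ` \<N> \<subseteq> Pow (topspace X)"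
    by (auto dest: in_closure_of[THEN iffD1])
  fix U x assume "openin X U \<and> x \<in> U"
  then obtain V where V: "openin X V" "x \<in> V" "X closure_of V \<subseteq> U"
    using regular_open_shrink assms(1) by metis
  then obtain N where N: "N \<in> \<N>" "x \<in> N" "N \<subseteq> V" "N \<subseteq> topspace X"
    using network_inE[OF assms(2)] by metis
  have "x \<in> X closure_of N" "X closure_of N \<subseteq> U"
    using closure_of_subset[OF N(4)] N closure_of_mono[OF N(3), of X] V by auto
  with N show "\<exists>N\<in>(closure_of) X ` \<N>. x \<in> N \<and> N \<subseteq> U" by blast
qed

lemma as_network_closures:
  assumes "regular_space X" "as_network_in X \<N>"
  shows "as_network_in X ((closure_of) X ` \<N>)"
  unfolding as_network_in_def
proof (intro conjI allI impI)
  show "(closure_of) X ` \<N> \<subseteq> Pow (topspace X)"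
    by (auto dest: in_closure_of[THEN iffD1])
  fix U and S :: "nat \<Rightarrow> 'a set" and x
  assume *: "openin X U \<and> (\<forall>n. closedin X (S n)) \<and> x \<in> U \<and> accumulates_at X S x"
  then obtain V where V: "openin X V" "x \<in> V" "X closure_of V \<subseteq> U"
    using regular_open_shrink assms(1) by metis
  with * obtain N where N: "N \<in> \<N>" "N \<subseteq> V" "infinite {n. N \<inter> S n \<noteq> {}}" "N \<subseteq> topspace X"
    using as_network_inE[OF assms(2) V(1), of S x] by metis
  have "N \<subseteq> X closure_of N" "X closure_of N \<subseteq> U"
    using closure_of_subset[OF N(4)] closure_of_mono[OF N(2), of X] V by auto
  moreover from this have "infinite {n. X closure_of N \<inter> S n \<noteq> {}}"
    using N(3) by (rule_tac infinite_super[of "{n. N \<inter> S n \<noteq> {}}"]) auto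
  ultimately show "\<exists>N\<in>(closure_of) X ` \<N>. N \<subseteq> U \<and> infinite {n. N \<inter> S n \<noteq> {}}"
    using N(1) by blast
qed

section \<open>Approximating points by a countable set\<close>

definition witness :: "'a topology \<Rightarrow> 'a set set \<Rightarrow> 'a" where
  "witness X F = (SOME y. y \<in> topspace X \<inter> \<Inter>F)"

definition witness_set :: "'a topology \<Rightarrow> 'a set set \<Rightarrow> 'a set" where
  "witness_set X \<N> = witness X ` {F. finite F \<and> F \<subseteq> \<N> \<and> topspace X \<inter> \<Inter>F \<noteq> {}}"

text \<open>Each stage contributes a finite family of sets rather than a single set, so that a stage can be
  a whole finite cover of a compact set.\<close>

definition approximant :: "'a topology \<Rightarrow> (nat \<Rightarrow> 'a set set) \<Rightarrow> nat \<Rightarrow> 'a \<Rightarrow> 'a" where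
  "approximant X E n x = witness X {N \<in> \<Union>i\<le>n. E i. x \<in> N}"

lemma witness_in: "x \<in> topspace X \<inter> \<Inter>F \<Longrightarrow> witness X F \<in> topspace X \<inter> \<Inter>F"
  unfolding witness_def by (rule someI)

lemma countable_witness_set: "countable \<N> \<Longrightarrow> countable (witness_set X \<N>)"
  unfolding witness_set_def
  by (rule countable_image, rule countable_subset[OF _ countable_Collect_finite_subset[of \<N>]]) auto

lemma witness_set_subset: "witness_set X \<N> \<subseteq> topspace X"
  unfolding witness_set_def using witness_in by fastforce

lemma approximant_in_topspace: "x \<in> topspace X \<Longrightarrow> approximant X E n x \<in> topspace X"
  using witness_in[of x X "{N \<in> \<Union>i\<le>n. E i. x \<in> N}"] unfolding approximant_def by auto

lemma approximant_in_witness_set: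
  assumes "x \<in> topspace X" "\<And>i. finite (E i)" "\<And>i. E i \<subseteq> \<N>"
  shows "approximant X E n x \<in> witness_set X \<N>"
proof -
  let ?F = "{N \<in> \<Union>i\<le>n. E i. x \<in> N}"
  have "finite ?F" "?F \<subseteq> \<N>" "x \<in> topspace X \<inter> \<Inter>?F"
    using assms by auto
  then show ?thesis
    unfolding approximant_def witness_set_def by blast
qed

lemma approximant_in:
  assumes "x \<in> topspace X" "x \<in> N" "N \<in> E i" "i \<le> n"
  shows "approximant X E n x \<in> N"
  using witness_in[of x X "{N \<in> \<Union>i\<le>n. E i. x \<in> N}"] assms unfolding approximant_def by auto

text \<open>The approximants at one stage depend only on which of finitely many sets contain the point.\<close>

lemma finite_approximants:
  assumes "\<And>i. finite (E i)"
  shows "finite (approximant X E n ` K)"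
proof (rule finite_subset)
  show "approximant X E n ` K \<subseteq> witness X ` Pow (\<Union>i\<le>n. E i)"
    unfolding approximant_def by auto
qed (use assms in auto)

lemma limitin_approximant:
  assumes x: "x \<in> topspace X"
    and E: "\<And>U. openin X U \<Longrightarrow> x \<in> U \<Longrightarrow> \<exists>i. \<exists>N\<in>E i. x \<in> N \<and> N \<subseteq> U"
  shows "limitin X (\<lambda>n. approximant X E n x) x sequentially"
  unfolding limitin_sequentially
proof (intro conjI allI impI x)
  fix U assume "openin X U \<and> x \<in> U"
  then obtain i N where "N \<in> E i" "x \<in> N" "N \<subseteq> U"
    using E by blast
  then show "\<exists>i. \<forall>n\<ge>i. approximant X E n x \<in> U"
    using approximant_in[OF x] by blast
qed

theorem cosmic_imp_cs_separable:
  assumes "cosmic_space X"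
  shows "cs_separable_space X"
proof -
  obtain \<N> where \<N>: "countable \<N>" "network_in X \<N>"
    using assms unfolding cosmic_space_def by blast
  define E where "E = (\<lambda>i::nat. {from_nat_into \<N> i})"
  have "\<exists>s :: nat \<Rightarrow> 'a. range s \<subseteq> witness_set X \<N> \<and> limitin X s x sequentially"
    if x: "x \<in> topspace X" for x
  proof (intro exI conjI)
    have "\<N> \<noteq> {}"
      using \<N>(2) x unfolding network_in_def by blast
    then have "E i \<subseteq> \<N>" for i
      unfolding E_def by (simp add: from_nat_into)
    then show "range (\<lambda>n. approximant X E n x) \<subseteq> witness_set X \<N>"
      using approximant_in_witness_set[OF x, of E \<N>] by (auto simp: E_def)
    show "limitin X (\<lambda>n. approximant X E n x) x sequentially"
    proof (rule limitin_approximant[OF x])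
      fix U assume "openin X U" "x \<in> U"
      then obtain N where N: "N \<in> \<N>" "x \<in> N" "N \<subseteq> U"
        using network_inE[OF \<N>(2)] by metis
      then show "\<exists>i. \<exists>N\<in>E i. x \<in> N \<and> N \<subseteq> U"
        unfolding E_def using from_nat_into_surj[OF \<N>(1) N(1)] by auto
    qed
  qed
  then show ?thesis
    unfolding cs_separable_space_def
    using countable_witness_set[OF \<N>(1)] witness_set_subset
    by (intro exI[of _ "witness_set X \<N>"]) simp
qed

section \<open>A coarser metrizable topology\<close>

lemma countable_network_imp_Lindelof:
  assumes "countable \<N>" "network_in X \<N>"
  shows "Lindelof_space X"
  unfolding Lindelof_space_def
proof (intro allI impI)
  fix \<U> assume \<U>: "(\<forall>U\<in>\<U>. openin X U) \<and> \<Union>\<U> = topspace X"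
  define \<M> where "\<M> = {N \<in> \<N>. \<exists>U\<in>\<U>. N \<subseteq> U}"
  have "\<forall>N\<in>\<M>. \<exists>U. U \<in> \<U> \<and> N \<subseteq> U"
    unfolding \<M>_def by blast
  then obtain u where u: "\<And>N. N \<in> \<M> \<Longrightarrow> u N \<in> \<U> \<and> N \<subseteq> u N"
    by metis
  have "countable (u ` \<M>)"
    using assms(1) unfolding \<M>_def by auto
  moreover have "u ` \<M> \<subseteq> \<U>"
    using u by blast
  moreover have "topspace X \<subseteq> \<Union>(u ` \<M>)"
  proof
    fix x assume "x \<in> topspace X"
    then obtain U where U: "U \<in> \<U>" "x \<in> U" "openin X U"
      using \<U> by blast
    then obtain N where "N \<in> \<N>" "x \<in> N" "N \<subseteq> U"
      using network_inE[OF assms(2)] by metis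
    then show "x \<in> \<Union>(u ` \<M>)"
      using u[of N] U unfolding \<M>_def by blast
  qed
  ultimately show "\<exists>\<V>. countable \<V> \<and> \<V> \<subseteq> \<U> \<and> \<Union>\<V> = topspace X"
    using \<U> by (intro exI[of _ "u ` \<M>"]) blast
qed

text \<open>The functions together embed the space, with the topology they induce, into a countable power
  of the real line.\<close>

lemma metrizable_from_separating_functions:
  fixes f :: "nat \<Rightarrow> 'a \<Rightarrow> real"
  assumes cont: "\<And>n. continuous_map X euclideanreal (f n)"
    and sep: "\<And>x y. x \<in> topspace X \<Longrightarrow> y \<in> topspace X \<Longrightarrow> x \<noteq> y \<Longrightarrow> \<exists>n. f n x \<noteq> f n y"
  obtains Y where "topspace Y = topspace X" "\<And>U. openin Y U \<Longrightarrow> openin X U" "metrizable_space Y"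
    "\<And>n. continuous_map Y euclideanreal (f n)"
proof -
  define F where "F = (\<lambda>x n. f n x)"
  define Y where "Y = pullback_topology (topspace X) F euclidean"
  have top: "topspace Y = topspace X"
    unfolding Y_def topspace_pullback_topology by simp
  have "continuous_map X (product_topology (\<lambda>n. euclideanreal) UNIV) F"
    unfolding continuous_map_componentwise_UNIV F_def using cont by simp
  then have contF: "continuous_map X euclidean F"
    by (simp add: euclidean_product_topology)
  have coarser: "openin X U" if U: "openin Y U" for U
  proof -
    obtain T where T: "openin euclidean T" "U = F -` T \<inter> topspace X"
      using U unfolding Y_def openin_pullback_topology by blast
    then have "U = {x \<in> topspace X. F x \<in> T}" by auto
    then show ?thesis
      using openin_continuous_map_preimage[OF contF T(1)] by simp
  qed
  have contY: "continuous_map Y euclidean F"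
    using continuous_map_pullback[OF continuous_map_id, of "topspace X" F euclidean]
    unfolding Y_def by simp
  then have "continuous_map Y (product_topology (\<lambda>n. euclideanreal) UNIV) F"
    by (simp add: euclidean_product_topology)
  then have comp: "continuous_map Y euclideanreal (f n)" for n
    unfolding continuous_map_componentwise_UNIV F_def by simp
  have inj: "inj_on F (topspace Y)"
    using sep unfolding inj_on_def top F_def by metis
  have "open_map Y (subtopology euclidean (F ` topspace Y)) F"
    unfolding open_map_def
  proof (intro allI impI)
    fix U assume "openin Y U"
    then obtain T where T: "openin euclidean T" "U = F -` T \<inter> topspace X"
      unfolding Y_def openin_pullback_topology by blast
    then have "F ` U = T \<inter> F ` topspace Y"
      unfolding top by auto
    then show "openin (subtopology euclidean (F ` topspace Y)) (F ` U)"
      using T(1) unfolding openin_subtopology by blast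
  qed
  then have "homeomorphic_map Y (subtopology euclidean (F ` topspace Y)) F"
    using contY inj
    by (intro bijective_open_imp_homeomorphic_map) (auto simp: continuous_map_in_subtopology)
  then have "Y homeomorphic_space subtopology euclidean (F ` topspace Y)"
    using homeomorphic_map_imp_homeomorphic_space by blast
  then have "metrizable_space Y"
    using homeomorphic_metrizable_space metrizable_space_subtopology metrizable_space_euclidean
    by blast
  with that top coarser comp show ?thesis by blast
qed

text \<open>The separation property of the coarser topology concerns only disjoint members of the given
  network. In general it cannot separate all disjoint sets closed in the original topology, for it
  would then have to coincide with that topology.\<close>

lemma cosmic_coarser_metrizable:
  assumes "regular_space X" "Hausdorff_space X" "countable \<N>" "network_in X \<N>"
    and closed: "\<And>N. N \<in> \<N> \<Longrightarrow> closedin X N"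
  obtains Y where "topspace Y = topspace X" "\<And>U. openin Y U \<Longrightarrow> openin X U" "metrizable_space Y"
    "\<And>M N. M \<in> \<N> \<Longrightarrow> N \<in> \<N> \<Longrightarrow> disjnt M N \<Longrightarrow>
       \<exists>G. openin Y G \<and> M \<subseteq> G \<and> disjnt (X closure_of G) N"
proof -
  have normal: "normal_space X"
    using assms countable_network_imp_Lindelof regular_Lindelof_imp_normal_space by blast
  define P where "P = {(M, N). M \<in> \<N> \<and> N \<in> \<N> \<and> disjnt M N}"
  have "countable P"
    by (rule countable_subset[of _ "\<N> \<times> \<N>"]) (use assms(3) in \<open>auto simp: P_def\<close>)
  \<comment> \<open>If \<open>P\<close> is empty, its enumeration takes values outside it; a constant function serves there.\<close>
  have "\<exists>h. continuous_map X euclideanreal h \<and> (p \<in> P \<longrightarrow> h ` fst p \<subseteq> {0} \<and> h ` snd p \<subseteq> {1})"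
    for p
  proof (cases "p \<in> P")
    case True
    then have "closedin X (fst p)" "closedin X (snd p)" "disjnt (fst p) (snd p)"
      using closed unfolding P_def by auto
    then obtain h where "continuous_map X euclideanreal h" "h ` fst p \<subseteq> {0}" "h ` snd p \<subseteq> {1}"
      using Urysohn_lemma_alt[OF normal] by metis
    then show ?thesis by blast
  next
    case False
    then show ?thesis
      by (intro exI[of _ "\<lambda>x. 0"]) simp
  qed
  then obtain h where h: "\<And>p. continuous_map X euclideanreal (h p)"
    "\<And>p. p \<in> P \<Longrightarrow> h p ` fst p \<subseteq> {0} \<and> h p ` snd p \<subseteq> {1}"
    by metis
  define f where "f = (\<lambda>n. h (from_nat_into P n))"
  have f: "\<exists>n. f n ` M \<subseteq> {0} \<and> f n ` N \<subseteq> {1}" if MN: "(M, N) \<in> P" for M N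
  proof -
    obtain n where "from_nat_into P n = (M, N)"
      using from_nat_into_surj[OF \<open>countable P\<close> MN] by blast
    then show ?thesis
      using h(2)[OF MN] unfolding f_def by (intro exI[of _ n]) simp
  qed
  have "\<exists>n. f n x \<noteq> f n y" if xy: "x \<in> topspace X" "y \<in> topspace X" "x \<noteq> y" for x y
  proof -
    obtain U V where UV: "openin X U" "openin X V" "x \<in> U" "y \<in> V" "disjnt U V"
      using assms(2) xy unfolding Hausdorff_space_def by blast
    then obtain M N where MN: "M \<in> \<N>" "x \<in> M" "M \<subseteq> U" "N \<in> \<N>" "y \<in> N" "N \<subseteq> V"
      using network_inE[OF assms(4)] by metis
    then have "(M, N) \<in> P"
      using UV(5) unfolding P_def disjnt_iff by blast
    then obtain n where "f n ` M \<subseteq> {0}" "f n ` N \<subseteq> {1}"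
      using f by blast
    then have "f n x = 0" "f n y = 1" using MN by auto
    then show ?thesis by (intro exI[of _ n]) simp
  qed
  moreover have fcont: "continuous_map X euclideanreal (f n)" for n
    unfolding f_def by (rule h(1))
  ultimately obtain Y where Y: "topspace Y = topspace X" "\<And>U. openin Y U \<Longrightarrow> openin X U"
    "metrizable_space Y" "\<And>n. continuous_map Y euclideanreal (f n)"
    using metrizable_from_separating_functions by metis
  have "\<exists>G. openin Y G \<and> M \<subseteq> G \<and> disjnt (X closure_of G) N"
    if MN: "M \<in> \<N>" "N \<in> \<N>" "disjnt M N" for M N
  proof -
    obtain n where n: "f n ` M \<subseteq> {0}" "f n ` N \<subseteq> {1}"
      using f MN unfolding P_def by blast
    define G where "G = {x \<in> topspace Y. f n x \<in> {..<1/2}}"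
    have "openin Y G"
      unfolding G_def by (rule openin_continuous_map_preimage[OF Y(4)]) simp
    moreover have "M \<subseteq> G"
      using n(1) closedin_subset[OF closed[OF MN(1)]] Y(1) unfolding G_def by force
    moreover have "closedin X {x \<in> topspace X. f n x \<in> {..1/2}}"
      by (rule closedin_continuous_map_preimage[OF fcont]) simp
    then have "X closure_of G \<subseteq> {x \<in> topspace X. f n x \<in> {..1/2}}"
      by (rule closure_of_minimal[rotated]) (auto simp: G_def Y(1))
    then have "disjnt (X closure_of G) N"
      using n(2) unfolding disjnt_iff by force
    ultimately show ?thesis by blast
  qed
  with Y that show ?thesis by blast
qed

section \<open>Compact sets and cs-networks\<close>

text \<open>On a compact set, a coarser Hausdorff topology induces the same
  subspace topology; if it is metrizable, then compactness gives sequential compactness.\<close>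

lemma compactin_imp_seq_compact:
  assumes Y: "topspace Y = topspace X" "\<And>U. openin Y U \<Longrightarrow> openin X U" "metrizable_space Y"
    and K: "compactin X K" and \<sigma>: "range \<sigma> \<subseteq> K"
  obtains l and r :: "nat \<Rightarrow> nat"
  where "l \<in> K" "strict_mono r" "limitin X (\<sigma> \<circ> r) l sequentially"
proof -
  have KX: "K \<subseteq> topspace X"
    using K compactin_subset_topspace by blast
  have "homeomorphic_map (subtopology X K) (subtopology Y K) id"
  proof (rule continuous_imp_homeomorphic_map)
    show "continuous_map (subtopology X K) (subtopology Y K) id"
      unfolding continuous_map_def
    proof (intro conjI allI impI)
      show "id \<in> topspace (subtopology X K) \<rightarrow> topspace (subtopology Y K)"
        using Y(1) by auto
      fix U assume "openin (subtopology Y K) U"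
      then obtain T where T: "openin Y T" "U = T \<inter> K"
        unfolding openin_subtopology by blast
      then have "{x \<in> topspace (subtopology X K). id x \<in> U} = T \<inter> K"
        using KX by auto
      then show "openin (subtopology X K) {x \<in> topspace (subtopology X K). id x \<in> U}"
        unfolding openin_subtopology using Y(2)[OF T(1)] by blast
    qed
    show "compact_space (subtopology X K)"
      using K compact_space_subtopology by blast
    show "Hausdorff_space (subtopology Y K)"
      using Y(3) by (simp add: Hausdorff_space_subtopology metrizable_imp_Hausdorff_space)
  qed (auto simp: Y(1))
  then have eq: "subtopology Y K = subtopology X K"
    by simp
  then have KY: "compactin Y K"
    using K KX Y(1) by (simp add: compactin_subspace)
  obtain M d where Md: "Metric_space M d" "Y = Metric_space.mtopology M d"
    using Y(3) unfolding metrizable_space_def by blast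
  obtain l and r :: "nat \<Rightarrow> nat"
    where l: "l \<in> K" "strict_mono r" "limitin Y (\<sigma> \<circ> r) l sequentially"
    using KY \<sigma> Metric_space.compactin_sequentially[OF Md(1), of K] unfolding Md(2) by blast
  have "limitin (subtopology Y K) (\<sigma> \<circ> r) l sequentially"
    using l \<sigma> unfolding limitin_subtopology by (auto simp: image_subset_iff)
  then have "limitin X (\<sigma> \<circ> r) l sequentially"
    unfolding eq limitin_subtopology by blast
  with l that show ?thesis by blast
qed

text \<open>If no finite subfamily of the members inside \<open>U\<close> covers \<open>K\<close>, choose the \<open>n\<close>-th point of a
  sequence in \<open>K\<close> outside the members enumerated up to \<open>n\<close>. A convergent subsequence meets each of these
  members only finitely often.\<close>

lemma cs_network_finite_cover:
  assumes X: "regular_space X" "Hausdorff_space X" and \<N>: "countable \<N>" "cs_network_in X \<N>"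
    and K: "compactin X K" and U: "openin X U" "K \<subseteq> U"
  obtains F where "finite F" "F \<subseteq> \<N>" "K \<subseteq> \<Union>F" "\<Union>F \<subseteq> U"
proof -
  have "network_in X ((closure_of) X ` \<N>)"
    using X(1) \<N>(2) cs_network_imp_network network_closures by blast
  then obtain Y where Y: "topspace Y = topspace X" "\<And>U. openin Y U \<Longrightarrow> openin X U"
    "metrizable_space Y"
    using cosmic_coarser_metrizable[OF X countable_image[OF \<N>(1)]] by (metis closedin_closure_of imageE)
  define \<M> where "\<M> = {N \<in> \<N>. N \<subseteq> U}"
  have "countable \<M>"
    using \<N>(1) unfolding \<M>_def by simp
  have "\<exists>F. finite F \<and> F \<subseteq> \<M> \<and> K \<subseteq> \<Union>F"
  proof (rule ccontr)
    assume contra: "\<nexists>F. finite F \<and> F \<subseteq> \<M> \<and> K \<subseteq> \<Union>F"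
    have "\<exists>x. x \<in> K \<and> x \<notin> \<Union>(from_nat_into \<M> ` {..n} \<inter> \<M>)" for n
    proof -
      have "finite (from_nat_into \<M> ` {..n} \<inter> \<M>)" by simp
      then have "\<not> K \<subseteq> \<Union>(from_nat_into \<M> ` {..n} \<inter> \<M>)"
        using contra by (metis inf_le2)
      then show ?thesis by blast
    qed
    then obtain \<sigma> where \<sigma>: "\<And>n. \<sigma> n \<in> K" "\<And>n. \<sigma> n \<notin> \<Union>(from_nat_into \<M> ` {..n} \<inter> \<M>)"
      by metis
    obtain l and r :: "nat \<Rightarrow> nat"
      where l: "l \<in> K" "strict_mono r" "limitin X (\<sigma> \<circ> r) l sequentially"
      using compactin_imp_seq_compact[OF Y K, of \<sigma>] \<sigma>(1) by blast
    have "range (\<sigma> \<circ> r) \<subseteq> topspace X" "l \<in> U"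
      using \<sigma>(1) l(1) U compactin_subset_topspace[OF K] by auto
    then obtain N where N: "N \<in> \<N>" "N \<subseteq> U" "infinite {n. (\<sigma> \<circ> r) n \<in> N}"
      using \<N>(2) U(1) l(3) unfolding cs_network_in_def by meson
    then have "N \<in> \<M>" unfolding \<M>_def by blast
    then obtain i where i: "from_nat_into \<M> i = N"
      using from_nat_into_surj[OF \<open>countable \<M>\<close>] by blast
    have "\<sigma> (r n) \<notin> N" if "i \<le> n" for n
    proof -
      have "i \<le> r n"
        using that seq_suble[OF l(2), of n] by simp
      then have "N \<in> from_nat_into \<M> ` {..r n} \<inter> \<M>"
        using i \<open>N \<in> \<M>\<close> by blast
      then show ?thesis using \<sigma>(2) by blast
    qed
    then have "{n. (\<sigma> \<circ> r) n \<in> N} \<subseteq> {..<i}"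
      by (auto simp: not_le[symmetric])
    then show False
      using N(3) finite_subset by blast
  qed
  then show ?thesis
    using that unfolding \<M>_def by blast
qed

text \<open>Every neighbourhood of \<open>K\<close> contains some cover \<open>E i\<close> and hence all approximants from stage
  \<open>i\<close> on; only the finitely many approximants of earlier stages can lie outside.\<close>

lemma compactin_with_approximants:
  assumes K: "compactin X K" and fin: "\<And>i. finite (E i)"
    and cover: "\<And>i. K \<subseteq> \<Union>(E i)"
    and nbhd: "\<And>U. openin X U \<Longrightarrow> K \<subseteq> U \<Longrightarrow> \<exists>i. \<Union>(E i) \<subseteq> U"
  shows "compactin X (K \<union> (\<Union>n. approximant X E n ` K))" (is "compactin X ?C")
proof -
  have KX: "K \<subseteq> topspace X"
    using K compactin_subset_topspace by blast
  have CX: "?C \<subseteq> topspace X"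
    using KX approximant_in_topspace[of _ X E] by auto
  show ?thesis
    unfolding compactin_def
  proof (intro conjI allI impI CX)
    fix \<U> assume "(\<forall>U\<in>\<U>. openin X U) \<and> ?C \<subseteq> \<Union>\<U>"
    then have \<U>: "\<And>U. U \<in> \<U> \<Longrightarrow> openin X U" and C\<U>: "?C \<subseteq> \<Union>\<U>"
      by auto
    have "K \<subseteq> \<Union>\<U>"
      using C\<U> by (rule order_trans[OF Un_upper1])
    then obtain \<V> where \<V>: "finite \<V>" "\<V> \<subseteq> \<U>" "K \<subseteq> \<Union>\<V>"
      using compactinD[OF K \<U>] by metis
    then have "openin X (\<Union>\<V>)"
      by (intro openin_Union) (use \<U> in auto)
    then obtain i where i: "\<Union>(E i) \<subseteq> \<Union>\<V>"
      using nbhd \<V>(3) by blast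
    have late: "approximant X E n x \<in> \<Union>\<V>" if xK: "x \<in> K" and "i \<le> n" for n x
    proof -
      obtain N where "N \<in> E i" "x \<in> N"
        using cover[of i] xK by blast
      then have "approximant X E n x \<in> N"
        using approximant_in xK KX \<open>i \<le> n\<close> by (metis subsetD)
      then show ?thesis
        using i \<open>N \<in> E i\<close> by (meson UnionI subsetD)
    qed
    define R where "R = (\<Union>n<i. approximant X E n ` K)"
    have "finite R"
      unfolding R_def by (intro finite_UN_I finite_lessThan finite_approximants fin)
    have R: "R \<subseteq> ?C"
      unfolding R_def by (intro le_supI2 UN_mono) auto
    have "compactin X R"
      using finite_imp_compactin[OF order_trans[OF R CX] \<open>finite R\<close>] .
    then obtain \<W> where \<W>: "finite \<W>" "\<W> \<subseteq> \<U>" "R \<subseteq> \<Union>\<W>"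
      using compactinD[OF _ \<U>, of R \<U>] order_trans[OF R C\<U>] by metis
    have "approximant X E n x \<in> \<Union>\<V> \<union> \<Union>\<W>" if "x \<in> K" for n x
    proof (cases "i \<le> n")
      case True
      then show ?thesis using late[OF that] by simp
    next
      case False
      then have "approximant X E n x \<in> R"
        unfolding R_def using that by auto
      then show ?thesis using \<W>(3) by auto
    qed
    then have "?C \<subseteq> \<Union>(\<V> \<union> \<W>)"
      using \<V>(3) by (simp add: UN_subset_iff image_subset_iff le_supI1)
    then show "\<exists>\<F>. finite \<F> \<and> \<F> \<subseteq> \<U> \<and> ?C \<subseteq> \<Union>\<F>"
      using \<V>(1,2) \<W>(1,2) by (intro exI[of _ "\<V> \<union> \<W>"]) simp
  qed
qed

theorem cs_cosmic_imp_k_separable: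
  assumes "cs_cosmic_space X"
  shows "k_separable_space X"
proof -
  have X: "regular_space X" "Hausdorff_space X"
    using assms unfolding cs_cosmic_space_def by auto
  obtain \<N> where \<N>: "countable \<N>" "cs_network_in X \<N>"
    using assms unfolding cs_cosmic_space_def by blast
  note finite_cover = cs_network_finite_cover[OF X \<N>]
  let ?D = "witness_set X \<N>"
  have "\<exists>C. compactin X C \<and> K \<subseteq> C \<and> K \<subseteq> X closure_of (C \<inter> ?D)" if K: "compactin X K" for K
  proof -
    have KX: "K \<subseteq> topspace X"
      using K compactin_subset_topspace by blast
    define \<C> where "\<C> = {F. finite F \<and> F \<subseteq> \<N> \<and> K \<subseteq> \<Union>F}"
    have "countable \<C>"
      by (rule countable_subset[OF _ countable_Collect_finite_subset[OF \<N>(1)]]) (auto simp: \<C>_def)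
    have cover: "\<exists>F\<in>\<C>. \<Union>F \<subseteq> U" if "openin X U" "K \<subseteq> U" for U
      using finite_cover[OF K that] unfolding \<C>_def by (metis (mono_tags, lifting) mem_Collect_eq)
    have "\<C> \<noteq> {}"
      using cover[OF openin_topspace KX] by blast
    define E where "E = from_nat_into \<C>"
    have "E i \<in> \<C>" for i
      unfolding E_def using \<open>\<C> \<noteq> {}\<close> by (rule from_nat_into)
    then have E: "finite (E i)" "E i \<subseteq> \<N>" "K \<subseteq> \<Union>(E i)" for i
      unfolding \<C>_def by auto
    have surj: "\<exists>i. E i = F" if "F \<in> \<C>" for F
      unfolding E_def using from_nat_into_surj[OF \<open>countable \<C>\<close> that] by blast
    define C where "C = K \<union> (\<Union>n. approximant X E n ` K)"
    have "compactin X C"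
      unfolding C_def
    proof (rule compactin_with_approximants[OF K E(1,3)])
      fix U assume "openin X U" "K \<subseteq> U"
      then show "\<exists>i. \<Union>(E i) \<subseteq> U"
        using cover surj by metis
    qed
    moreover have "x \<in> X closure_of (C \<inter> ?D)" if "x \<in> K" for x
    proof -
      have x: "x \<in> topspace X" using that KX by blast
      have lim: "limitin X (\<lambda>n. approximant X E n x) x sequentially"
      proof (rule limitin_approximant[OF x])
        fix U assume U: "openin X U" "x \<in> U"
        \<comment> \<open>A cover of \<open>K\<close> all of whose members around \<open>x\<close> lie in \<open>U\<close>: cover the part of \<open>K\<close> near
          \<open>x\<close> inside \<open>U\<close> and the rest inside the complement of \<open>x\<close>.\<close>
        obtain V where V: "openin X V" "x \<in> V" "X closure_of V \<subseteq> U"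
          using regular_open_shrink[OF X(1) U] by blast
        have "compactin X (K \<inter> X closure_of V)"
          by (rule compact_Int_closedin[OF K closedin_closure_of])
        then obtain F1 where F1: "finite F1" "F1 \<subseteq> \<N>" "K \<inter> X closure_of V \<subseteq> \<Union>F1" "\<Union>F1 \<subseteq> U"
          using finite_cover[OF _ U(1), of "K \<inter> X closure_of V"] V(3) by (metis inf.coboundedI2)
        have "closedin X {x}"
          using x X(2) by (simp add: closedin_Hausdorff_sing_eq)
        then have open_x: "openin X (topspace X - {x})"
          by blast
        have "compactin X (K \<inter> (topspace X - V))"
          by (rule compact_Int_closedin[OF K]) (use V(1) in blast)
        moreover have "K \<inter> (topspace X - V) \<subseteq> topspace X - {x}"
          using V(2) by blast
        ultimately obtain F2 where F2: "finite F2" "F2 \<subseteq> \<N>" "K \<inter> (topspace X - V) \<subseteq> \<Union>F2"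
          "\<Union>F2 \<subseteq> topspace X - {x}"
          using finite_cover[OF _ open_x] by metis
        have "K \<subseteq> \<Union>(F1 \<union> F2)"
          using F1(3) F2(3) KX closure_of_subset[OF openin_subset[OF V(1)]] by blast
        then have "F1 \<union> F2 \<in> \<C>"
          using F1(1,2) F2(1,2) by (simp add: \<C>_def)
        then obtain i where i: "E i = F1 \<union> F2"
          using surj by blast
        obtain N where "N \<in> E i" "x \<in> N"
          using E(3) \<open>x \<in> K\<close> by blast
        then show "\<exists>i. \<exists>N\<in>E i. x \<in> N \<and> N \<subseteq> U"
          using i F1(4) F2(4) by blast
      qed
      have mem: "approximant X E n x \<in> C \<inter> ?D" for n
        using approximant_in_witness_set[OF x, of E \<N>] E(1,2) \<open>x \<in> K\<close> unfolding C_def by blast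
      show ?thesis
        unfolding in_closure_of
      proof (intro conjI allI impI x)
        fix T assume "x \<in> T \<and> openin X T"
        then obtain n where "approximant X E n x \<in> T"
          using lim unfolding limitin_sequentially by blast
        then show "\<exists>y. y \<in> C \<inter> ?D \<and> y \<in> T"
          using mem by blast
      qed
    qed
    moreover have "K \<subseteq> C" unfolding C_def by blast
    ultimately show ?thesis by blast
  qed
  then show ?thesis
    unfolding k_separable_space_def
    using countable_witness_set[OF \<N>(1)] witness_set_subset
    by (intro exI[of _ "witness_set X \<N>"]) simp
qed

section \<open>Cometrizability\<close>

text \<open>Some neighbourhood of \<open>x\<close> meets only finitely many of the sets, and these, being closed, can
  be removed from it.\<close>

lemma not_accumulates_imp_open_avoids:
  assumes x: "x \<in> topspace X" and closed: "\<And>n. closedin X (S n)" and notin: "\<And>n. x \<notin> S n"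
    and "\<not> accumulates_at X S x"
  obtains W where "openin X W" "x \<in> W" "\<And>n. disjnt W (S n)"
proof -
  obtain W V where WV: "openin X V" "x \<in> V" "V \<subseteq> W" "finite {n. W \<inter> S n \<noteq> {}}"
    using assms(4) x unfolding accumulates_at_def by blast
  define I where "I = {n. W \<inter> S n \<noteq> {}}"
  define Q where "Q = V - (\<Union>n\<in>I. S n)"
  have "closedin X (\<Union>n\<in>I. S n)"
    using WV(4) closed unfolding I_def by (intro closedin_Union) auto
  then have "openin X Q"
    unfolding Q_def using WV(1) by blast
  moreover have "x \<in> Q"
    unfolding Q_def using WV(2) notin by blast
  moreover have "disjnt Q (S n)" for n
    using WV(3) unfolding Q_def I_def disjnt_iff by blast
  ultimately show ?thesis using that by blast
qed

theorem as_cosmic_imp_cometrizable: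
  assumes "as_cosmic_space X"
  shows "cometrizable_space X"
proof -
  have X: "regular_space X" "Hausdorff_space X"
    using assms unfolding as_cosmic_space_def by auto
  obtain \<N>0 where \<N>0: "countable \<N>0" "as_network_in X \<N>0"
    using assms unfolding as_cosmic_space_def by blast
  define \<N> where "\<N> = (closure_of) X ` \<N>0"
  have \<N>: "countable \<N>" "as_network_in X \<N>" "\<And>N. N \<in> \<N> \<Longrightarrow> closedin X N"
    using \<N>0 as_network_closures[OF X(1)] unfolding \<N>_def by auto
  have net: "network_in X \<N>"
    using as_network_imp_network[OF X(2) \<N>(2)] .
  obtain Y where Y: "topspace Y = topspace X" "\<And>U. openin Y U \<Longrightarrow> openin X U" "metrizable_space Y"
    and sep: "\<And>M N. M \<in> \<N> \<Longrightarrow> N \<in> \<N> \<Longrightarrow> disjnt M N \<Longrightarrow>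
       \<exists>G. openin Y G \<and> M \<subseteq> G \<and> disjnt (X closure_of G) N"
    using cosmic_coarser_metrizable[OF X \<N>(1) net \<N>(3)] by metis
  obtain g where g: "\<And>M N. M \<in> \<N> \<Longrightarrow> N \<in> \<N> \<Longrightarrow> disjnt M N \<Longrightarrow>
       openin Y (g M N) \<and> M \<subseteq> g M N \<and> disjnt (X closure_of (g M N)) N"
    using sep by metis
  have "\<exists>A B. openin X A \<and> closedin Y B \<and> x \<in> A \<and> A \<subseteq> B \<and> B \<subseteq> U"
    if U: "openin X U" "x \<in> U" for U x
  proof -
    obtain V where V: "openin X V" "x \<in> V" "X closure_of V \<subseteq> U"
      using regular_open_shrink[OF X(1) U] by blast
    have x: "x \<in> topspace X" using U openin_subset by blast
    have VX: "V \<subseteq> X closure_of V"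
      using closure_of_subset[OF openin_subset[OF V(1)]] .
    define \<I> where "\<I> = {N \<in> \<N>. N \<subseteq> V}"
    define \<O> where "\<O> = {M \<in> \<N>. M \<subseteq> topspace X - X closure_of V}"
    have cnt: "countable \<I>" "countable \<O>"
      using \<N>(1) unfolding \<I>_def \<O>_def by auto
    obtain N0 where "N0 \<in> \<N>" "x \<in> N0" "N0 \<subseteq> V"
      using network_inE[OF net V(1,2)] by metis
    then have N0: "N0 \<in> \<I>" "x \<in> N0"
      unfolding \<I>_def by auto
    define N where "N = from_nat_into \<I>"
    have N: "N i \<in> \<N>" "N i \<subseteq> V" for i
      using from_nat_into[of \<I> i] N0 unfolding N_def \<I>_def by auto
    \<comment> \<open>All closures will miss \<open>N k\<close>, so that none of them contains \<open>x\<close> itself.\<close>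
    obtain k where k: "N k = N0"
      using from_nat_into_surj[OF cnt(1) N0(1)] unfolding N_def by blast
    \<comment> \<open>\<open>\<O>\<close> can be empty when \<open>V\<close> is dense; the sequence of sets is then made empty.\<close>
    define G where "G = (\<lambda>j. if \<O> = {} then {} else \<Inter>i\<in>{..max j k}. g (from_nat_into \<O> j) (N i))"
    have sepO: "openin Y (g M (N i)) \<and> M \<subseteq> g M (N i) \<and> disjnt (X closure_of (g M (N i))) (N i)"
      if "M \<in> \<O>" for M i
      using g[of M "N i"] that N[of i] VX unfolding \<O>_def disjnt_iff by blast
    have openG: "openin Y (G j)" for j
    proof (cases "\<O> = {}")
      case True
      then show ?thesis by (simp add: G_def)
    next
      case False
      have "openin Y (\<Inter>i\<in>{..max j k}. g (from_nat_into \<O> j) (N i))"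
        by (rule openin_INT2) (use sepO[OF from_nat_into[OF False]] in auto)
      with False show ?thesis by (simp add: G_def)
    qed
    have missG: "disjnt (X closure_of (G j)) (N i)" if "i \<le> max j k" for i j
    proof (cases "\<O> = {}")
      case True
      then show ?thesis by (simp add: G_def)
    next
      case False
      then have "G j \<subseteq> g (from_nat_into \<O> j) (N i)"
        unfolding G_def using that by auto
      then have "X closure_of (G j) \<subseteq> X closure_of (g (from_nat_into \<O> j) (N i))"
        by (rule closure_of_mono)
      then show ?thesis
        using sepO[OF from_nat_into[OF False], of j i] unfolding disjnt_iff by blast
    qed
    define S where "S = (\<lambda>j. X closure_of (G j))"
    have "\<not> accumulates_at X S x"
    proof
      assume "accumulates_at X S x"
      then obtain L where L: "L \<in> \<N>" "L \<subseteq> V" "infinite {n. L \<inter> S n \<noteq> {}}"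
        using as_network_inE[OF \<N>(2) V(1), of S x] V(2) closedin_closure_of
        unfolding S_def by metis
      then obtain i where i: "N i = L"
        using from_nat_into_surj[OF cnt(1), of L] unfolding N_def \<I>_def by blast
      have L_miss: "L \<inter> S n = {}" if "i \<le> n" for n
        using missG[of i n] that i by (auto simp: S_def disjnt_iff le_max_iff_disj)
      have "{n. L \<inter> S n \<noteq> {}} \<subseteq> {..<i}"
        using L_miss by (metis (mono_tags, lifting) lessThan_iff mem_Collect_eq not_le subsetI)
      then show False
        using L(3) finite_subset by blast
    qed
    moreover have "x \<notin> S n" for n
      using missG[of k n] k N0(2) unfolding S_def disjnt_iff by auto
    ultimately obtain A where A: "openin X A" "x \<in> A" "\<And>n. disjnt A (S n)"
      using not_accumulates_imp_open_avoids[OF x, of S] unfolding S_def by auto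
    define B where "B = topspace Y - (\<Union>j. G j)"
    have "closedin Y B"
      unfolding B_def using openG by blast
    moreover have "A \<subseteq> B"
    proof -
      have "G j \<subseteq> S j" for j
        unfolding S_def using openin_subset[OF openG] Y(1) by (simp add: closure_of_subset)
      then show ?thesis
        using A(3) openin_subset[OF A(1)] Y(1) unfolding B_def disjnt_iff by blast
    qed
    moreover have "B \<subseteq> U"
    proof
      fix y assume y: "y \<in> B"
      show "y \<in> U"
      proof (rule ccontr)
        assume "y \<notin> U"
        then have "y \<in> topspace X - X closure_of V"
          using y V(3) Y(1) unfolding B_def by blast
        moreover have "openin X (topspace X - X closure_of V)"
          by (intro openin_diff openin_topspace closedin_closure_of)
        ultimately obtain M where "M \<in> \<N>" "y \<in> M" "M \<subseteq> topspace X - X closure_of V"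
          using network_inE[OF net] by metis
        then have M: "M \<in> \<O>" "y \<in> M"
          unfolding \<O>_def by auto
        then obtain j where "from_nat_into \<O> j = M"
          using from_nat_into_surj[OF cnt(2)] by blast
        then have "y \<in> G j"
          unfolding G_def using M sepO[OF M(1)] by auto
        then show False
          using y unfolding B_def by blast
      qed
    qed
    ultimately show ?thesis using A by blast
  qed
  then have "neighbourhood_base_of (closedin Y) X"
    unfolding neighbourhood_base_of by blast
  with Y show ?thesis
    unfolding cometrizable_space_def by blast
qed

theorem theorem1p12:
  shows "(\<forall>X :: 'a topology. cosmic_space X \<longrightarrow> cs_separable_space X) \<and>
         (\<forall>X :: 'a topology. cs_cosmic_space X \<longrightarrow> k_separable_space X) \<and>
         (\<forall>X :: 'a topology. as_cosmic_space X \<longrightarrow> cometrizable_space X)"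
  by (simp add: cosmic_imp_cs_separable cs_cosmic_imp_k_separable as_cosmic_imp_cometrizable)

end
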